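(* Let $\Omega\subseteq\mathbb{R}^N$ be a domain with $\Omega$ open and connected, let $p\ge2$ (with $p<\infty$), and let $v\in C^1(\Omega)$ be a fixed positive function. For $\psi\in C_{0+}^\infty(\Omega)$ define $$N(\psi):=\left[\int_\Omega\left(v^p|\nabla(\psi^{2/p})|^p+v^2|\nabla v|^{p-2}\psi^{2(p-2)/p}|\nabla(\psi^{2/p})|^2\right)\mathrm{d}x\right]^{1/2}.$$ Then $N$ is a norm on the cone $C_{0+}^\infty(\Omega)$ in the following sense: $N(\psi)>0$ for every $\psi\in C_{0+}^\infty(\Omega)$ unless $\psi=0$; $N(\lambda\psi)=\lambda N(\psi)$ for all $\lambda\ge0$ and $\psi\in C_{0+}^\infty(\Omega)$; and $$N(\psi_1+\psi_2)\le N(\psi_1)+N(\psi_2)\qquad\text{for all }\psi_1,\psi_2\in C_{0+}^\infty(\Omega).$$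
   Context: $C_{0+}^\infty(\Omega)$ denotes the convex cone of all nonnegative functions in $C_0^\infty(\Omega)$. The values of $N$ lie in $[0,+\infty]$, with the convention $0\cdot\infty=0$. The gradient $\nabla(\psi^{2/p})$ is understood as $\frac{2}{p}\psi^{2/p-1}\nabla\psi$ where $\psi>0$ and as $0$ where $\psi=0$. When $p=2$, the factors $|\nabla v|^{p-2}$ and $\psi^{2(p-2)/p}$ are equal to $1$. *)

theory Defs
  imports "HOL-Analysis.Analysis"
begin

definition grad :: "('a::euclidean_space \<Rightarrow> real) \<Rightarrow> 'a \<Rightarrow> 'a" where
  "grad f x = (\<Sum>b\<in>Basis. frechet_derivative f (at x) b *\<^sub>R b)"

(* The class C^k on an open set S. *)
primrec cont_diff :: "nat \<Rightarrow> 'a::euclidean_space set \<Rightarrow> ('a \<Rightarrow> real) \<Rightarrow> bool" where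
  "cont_diff 0 S f = continuous_on S f"
| "cont_diff (Suc k) S f =
     ((\<forall>x\<in>S. f differentiable (at x)) \<and>
      (\<forall>b\<in>Basis. cont_diff k S (\<lambda>x. frechet_derivative f (at x) b)))"

definition smooth_on :: "'a::euclidean_space set \<Rightarrow> ('a \<Rightarrow> real) \<Rightarrow> bool" where
  "smooth_on S f \<longleftrightarrow> (\<forall>k. cont_diff k S f)"

(* Test functions on \<Omega> are represented by their extension by zero to the whole space. *)
definition test_cone :: "'a::euclidean_space set \<Rightarrow> ('a \<Rightarrow> real) set" where
  "test_cone \<Omega> = {\<psi>. smooth_on \<Omega> \<psi> \<and> compact (closure {x. \<psi> x \<noteq> 0}) \<and>
     closure {x. \<psi> x \<noteq> 0} \<subseteq> \<Omega> \<and> (\<forall>x. 0 \<le> \<psi> x)}"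

(* Real powers with exponent 0 giving 1 also at base 0, whereas 0 powr 0 = 0. *)
definition rpow :: "real \<Rightarrow> real \<Rightarrow> real" where
  "rpow a s = (if s = 0 then 1 else a powr s)"

(* The gradient of \<psi> to the power 2/p, which is set to 0 where \<psi> vanishes. *)
definition grad_pow :: "real \<Rightarrow> ('a::euclidean_space \<Rightarrow> real) \<Rightarrow> 'a \<Rightarrow> 'a" where
  "grad_pow p \<psi> x =
     (if \<psi> x > 0 then (2 / p * \<psi> x powr (2 / p - 1)) *\<^sub>R grad \<psi> x else 0)"

definition ennsqrt :: "ennreal \<Rightarrow> ennreal" where
  "ennsqrt a = (if a = \<infinity> then \<infinity> else ennreal (sqrt (enn2real a)))"

definition cone_norm ::
  "'a::euclidean_space set \<Rightarrow> real \<Rightarrow> ('a \<Rightarrow> real) \<Rightarrow> ('a \<Rightarrow> real) \<Rightarrow> ennreal" where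
  "cone_norm \<Omega> p v \<psi> = ennsqrt (\<integral>\<^sup>+x\<in>\<Omega>. ennreal (
     v x powr p * norm (grad_pow p \<psi> x) powr p +
     (v x)\<^sup>2 * rpow (norm (grad v x)) (p - 2) * rpow (\<psi> x) (2 * (p - 2) / p) *
       (norm (grad_pow p \<psi> x))\<^sup>2) \<partial>lborel)"

end

theory Submission
  imports Defs
begin

text \<open>
  Where \<open>\<psi> > 0\<close>, the powers of \<open>\<psi>\<close> in the second term of the integrand cancel, and the integrand
  becomes \<open>(2/p)\<^sup>p v\<^sup>p \<psi>\<^bsup>2-p\<^esup> |\<nabla>\<psi>|\<^sup>p + (2/p)\<^sup>2 v\<^sup>2 |\<nabla>v|\<^bsup>p-2\<^esup> |\<nabla>\<psi>|\<^sup>2\<close>. With \<open>q = p/2 \<ge> 1\<close> the first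
  term is, up to its coefficient, the square of \<open>s (|\<xi>|/s)\<^sup>q\<close> at \<open>s = \<psi>\<close>, \<open>\<xi> = \<nabla>\<psi>\<close>. This expression
  is the perspective of the convex function \<open>|\<xi>|\<^sup>q\<close>, hence positively homogeneous and subadditive in
  \<open>(s, \<xi>)\<close> jointly (\<open>perspective_subadd\<close>). So the integrand is the square of the Euclidean length of
  a pair of sublinear nonnegative quantities, and that length (\<open>energy_root\<close>) is sublinear as well. Thus
  \<open>N(\<psi>)\<close> is the \<open>L\<^sup>2\<close>-norm of \<open>energy_root\<close> (\<open>cone_norm_eq\<close>), and the triangle inequality follows
  from the pointwise one and from Minkowski's inequality in \<open>L\<^sup>2\<close>, in a form that allows infinite
  integrals (\<open>ennsqrt_minkowski\<close>). At the zeros of \<open>\<psi>\<close> nothing is lost, because they are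
  minima, so that \<open>\<nabla>\<psi>\<close> vanishes there too.

  For positivity, \<open>N(\<psi>) = 0\<close> forces \<open>\<nabla>\<psi> = 0\<close> almost everywhere in \<open>\<Omega>\<close>, hence everywhere by
  continuity. The extension of \<open>\<psi>\<close> by zero is then constant on the whole space, and a constant with
  compact support is zero.
\<close>

section \<open>The square root on extended nonnegative reals and Minkowski's inequality\<close>

lemma ennsqrt_ennreal: "0 \<le> a \<Longrightarrow> ennsqrt (ennreal a) = ennreal (sqrt a)"
  by (simp add: ennsqrt_def)

lemma ennsqrt_top: "ennsqrt top = top"
  by (simp add: ennsqrt_def)

lemma ennsqrt_mono: "a \<le> b \<Longrightarrow> ennsqrt a \<le> ennsqrt b"
  by (cases a; cases b) (auto simp: ennsqrt_ennreal ennsqrt_top top_unique)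

lemma ennsqrt_eq_0_iff: "ennsqrt a = 0 \<longleftrightarrow> a = 0"
  by (cases a) (auto simp: ennsqrt_ennreal ennsqrt_top)

lemma ennsqrt_power2_mult:
  assumes "0 \<le> c"
  shows "ennsqrt ((ennreal c)\<^sup>2 * a) = ennreal c * ennsqrt a"
proof (cases "c = 0")
  case True
  then show ?thesis by (simp add: ennsqrt_eq_0_iff)
next
  case False
  with assms show ?thesis
    by (cases a)
      (auto simp: ennsqrt_ennreal ennsqrt_top ennreal_power ennreal_mult_top real_sqrt_mult
        simp flip: ennreal_mult)
qed

lemma ennsqrt_minkowski:
  assumes [measurable]: "f \<in> borel_measurable M" "g \<in> borel_measurable M"
  shows "ennsqrt (\<integral>\<^sup>+x. (f x + g x)\<^sup>2 \<partial>M)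
    \<le> ennsqrt (\<integral>\<^sup>+x. (f x)\<^sup>2 \<partial>M) + ennsqrt (\<integral>\<^sup>+x. (g x)\<^sup>2 \<partial>M)"
proof (cases "(\<integral>\<^sup>+x. (f x)\<^sup>2 \<partial>M) = top \<or> (\<integral>\<^sup>+x. (g x)\<^sup>2 \<partial>M) = top")
  case True
  then show ?thesis by (auto simp: ennsqrt_top)
next
  case False
  then obtain a b where a: "0 \<le> a" "(\<integral>\<^sup>+x. (f x)\<^sup>2 \<partial>M) = ennreal a"
    and b: "0 \<le> b" "(\<integral>\<^sup>+x. (g x)\<^sup>2 \<partial>M) = ennreal b"
    by (metis ennreal_cases infinity_ennreal_def)
  have cs: "(\<integral>\<^sup>+x. f x * g x \<partial>M)\<^sup>2 \<le> ennreal (a * b)"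
    using Cauchy_Schwarz_nn_integral[OF assms] a b by (simp add: ennreal_mult)
  then have "(\<integral>\<^sup>+x. f x * g x \<partial>M) \<noteq> top"
    by (auto simp: top_unique)
  then obtain c where c: "0 \<le> c" "(\<integral>\<^sup>+x. f x * g x \<partial>M) = ennreal c"
    by (metis ennreal_cases)
  have "c\<^sup>2 \<le> a * b"
    using cs a b c by (simp add: ennreal_power)
  then have "c \<le> sqrt a * sqrt b"
    using c by (metis real_le_rsqrt real_sqrt_mult)
  then have le: "a + 2 * c + b \<le> (sqrt a + sqrt b)\<^sup>2"
    using a b by (simp add: power2_sum)
  have "(\<integral>\<^sup>+x. (f x + g x)\<^sup>2 \<partial>M) = (\<integral>\<^sup>+x. (f x)\<^sup>2 + 2 * (f x * g x) + (g x)\<^sup>2 \<partial>M)"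
    by (intro nn_integral_cong) (simp only: power2_sum mult.assoc add.assoc add.commute[of "(g _)\<^sup>2"])
  also have "\<dots> = ennreal a + 2 * ennreal c + ennreal b"
    by (simp add: nn_integral_add nn_integral_cmult a b c)
  also have "\<dots> = ennreal (a + 2 * c + b)"
    using a b c by (simp add: ennreal_mult flip: ennreal_numeral)
  also have "\<dots> \<le> ennreal ((sqrt a + sqrt b)\<^sup>2)"
    using le by (rule ennreal_leI)
  finally have "ennsqrt (\<integral>\<^sup>+x. (f x + g x)\<^sup>2 \<partial>M) \<le> ennsqrt (ennreal ((sqrt a + sqrt b)\<^sup>2))"
    by (rule ennsqrt_mono)
  also have "\<dots> = ennreal (sqrt a) + ennreal (sqrt b)"
    using a b by (simp add: ennsqrt_ennreal)
  finally show ?thesis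
    using a b by (simp add: ennsqrt_ennreal)
qed

section \<open>The perspective of a power and the pointwise energy\<close>

lemma convex_on_powr_nonneg:
  assumes "1 \<le> q"
  shows "convex_on {0..} (\<lambda>x::real. x powr q)"
proof (rule convex_onI)
  have scale: "(t * z) powr q \<le> t * z powr q" if "0 < t" "t < 1" "0 \<le> z" for t z :: real
  proof -
    have "t powr q \<le> t powr 1"
      using that assms by (intro powr_mono') auto
    then show ?thesis
      using that by (simp add: powr_mult mult_right_mono)
  qed
  fix t x y :: real
  assume t: "0 < t" "t < 1" and xy: "x \<in> {0..}" "y \<in> {0..}"
  consider "x = 0" | "y = 0" | "0 < x" "0 < y"
    using xy by fastforce
  then show "((1 - t) *\<^sub>R x + t *\<^sub>R y) powr q \<le> (1 - t) * x powr q + t * y powr q"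
  proof cases
    case 1
    then show ?thesis using scale[of t y] t xy by simp
  next
    case 2
    then show ?thesis using scale[of "1 - t" x] t xy by simp
  next
    case 3
    then show ?thesis
      using convex_onD[OF powr_convex[OF assms], of t x y] t by simp
  qed
qed simp

text \<open>
  Convexity of \<open>x\<^sup>q\<close> at the points \<open>u\<^sub>i/s\<^sub>i\<close> with weights \<open>s\<^sub>i/(s\<^sub>1+s\<^sub>2)\<close>, multiplied by
  \<open>s\<^sub>1 + s\<^sub>2\<close>. Without the condition at \<open>s\<^sub>i = 0\<close> the claim is false, since division by zero makes the
  perspective vanish there.
\<close>

lemma perspective_subadd:
  fixes q :: real
  assumes "1 \<le> q" "0 \<le> s1" "0 \<le> s2" "0 \<le> u1" "0 \<le> u2"
    and "s1 = 0 \<Longrightarrow> u1 = 0" "s2 = 0 \<Longrightarrow> u2 = 0"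
  shows "(s1 + s2) * ((u1 + u2) / (s1 + s2)) powr q
    \<le> s1 * (u1 / s1) powr q + s2 * (u2 / s2) powr q"
proof -
  consider "s1 = 0" | "s2 = 0" | "0 < s1" "0 < s2"
    using assms by fastforce
  then show ?thesis
  proof cases
    case 3
    define t where "t = s2 / (s1 + s2)"
    have t: "0 \<le> t" "t \<le> 1" and t': "1 - t = s1 / (s1 + s2)"
      using 3 by (auto simp: t_def field_simps)
    have "(1 - t) * (u1 / s1) + t * (u2 / s2) = (u1 + u2) / (s1 + s2)"
      unfolding t' unfolding t_def using 3 by (simp add: add_divide_distrib)
    then have "((u1 + u2) / (s1 + s2)) powr q \<le> (1 - t) * (u1 / s1) powr q + t * (u2 / s2) powr q"
      using convex_onD[OF convex_on_powr_nonneg[OF assms(1)], of t "u1 / s1" "u2 / s2"] t 3 assms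
      by simp
    then have "(s1 + s2) * ((u1 + u2) / (s1 + s2)) powr q
        \<le> (s1 + s2) * ((1 - t) * (u1 / s1) powr q + t * (u2 / s2) powr q)"
      using 3 by (intro mult_left_mono) auto
    also have "\<dots> = s1 * (u1 / s1) powr q + s2 * (u2 / s2) powr q"
      unfolding t' unfolding t_def using 3 by (simp add: distrib_left)
    finally show ?thesis .
  qed (use assms in auto)
qed

text \<open>
  The square root of the integrand at a point where \<open>v = V\<close>, \<open>|\<nabla>v| = w\<close>, \<open>\<psi> = s\<close> and
  \<open>|\<nabla>\<psi>| = u\<close>. At \<open>s = 0\<close> the first component vanishes by the convention for division by zero,
  and the second one because \<open>u = 0\<close> at a zero of \<open>\<psi>\<close>.
\<close>

definition energy_root :: "real \<Rightarrow> real \<Rightarrow> real \<Rightarrow> real \<Rightarrow> real \<Rightarrow> real" where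
  "energy_root p V w s u =
     sqrt ((V powr (p / 2) * (2 / p) powr (p / 2) * (s * (u / s) powr (p / 2)))\<^sup>2
         + (V * sqrt (rpow w (p - 2)) * (2 / p) * u)\<^sup>2)"

lemma rpow_nonneg: "0 \<le> rpow a s"
  by (simp add: rpow_def)

lemma energy_root_nonneg: "0 \<le> energy_root p V w s u"
  by (simp add: energy_root_def)

lemma energy_root_mono:
  assumes "2 \<le> p" "0 \<le> V" "0 \<le> s" "0 \<le> u" "u \<le> u'"
  shows "energy_root p V w s u \<le> energy_root p V w s u'"
  unfolding energy_root_def
  using assms
  by (intro real_sqrt_le_mono add_mono power_mono mult_left_mono powr_mono2 divide_right_mono
      mult_nonneg_nonneg real_sqrt_ge_zero rpow_nonneg) auto

lemma energy_root_scale: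
  assumes "0 < c"
  shows "energy_root p V w (c * s) (c * u) = c * energy_root p V w s u"
proof -
  have "(V powr (p / 2) * (2 / p) powr (p / 2) * (c * s * (c * u / (c * s)) powr (p / 2)))\<^sup>2
         + (V * sqrt (rpow w (p - 2)) * (2 / p) * (c * u))\<^sup>2
    = c\<^sup>2 * ((V powr (p / 2) * (2 / p) powr (p / 2) * (s * (u / s) powr (p / 2)))\<^sup>2
         + (V * sqrt (rpow w (p - 2)) * (2 / p) * u)\<^sup>2)"
    using assms by (simp add: power_mult_distrib distrib_left power_divide mult_ac)
  then show ?thesis
    using assms by (simp add: energy_root_def real_sqrt_mult)
qed

lemma energy_root_subadd:
  assumes "2 \<le> p" "0 \<le> V" "0 \<le> s1" "0 \<le> s2" "0 \<le> u1" "0 \<le> u2"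
    and "s1 = 0 \<Longrightarrow> u1 = 0" "s2 = 0 \<Longrightarrow> u2 = 0"
  shows "energy_root p V w (s1 + s2) (u1 + u2) \<le> energy_root p V w s1 u1 + energy_root p V w s2 u2"
proof -
  define A where "A = V powr (p / 2) * (2 / p) powr (p / 2)"
  define B where "B = V * sqrt (rpow w (p - 2)) * (2 / p)"
  define h where "h s u = A * (s * (u / s) powr (p / 2))" for s u
  have A: "0 \<le> A" by (simp add: A_def)
  have B: "0 \<le> B" using assms by (simp add: B_def rpow_nonneg)
  have d: "energy_root p V w s u = sqrt ((h s u)\<^sup>2 + (B * u)\<^sup>2)" for s u
    by (simp add: energy_root_def A_def B_def h_def)
  have "h (s1 + s2) (u1 + u2) \<le> h s1 u1 + h s2 u2"
    unfolding h_def distrib_left[symmetric]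
    using assms A by (intro mult_left_mono perspective_subadd) auto
  moreover have "0 \<le> h (s1 + s2) (u1 + u2)"
    using A assms by (simp add: h_def)
  moreover have "0 \<le> B * (u1 + u2)"
    using B assms by simp
  ultimately have "energy_root p V w (s1 + s2) (u1 + u2)
      \<le> sqrt ((h s1 u1 + h s2 u2)\<^sup>2 + (B * u1 + B * u2)\<^sup>2)"
    unfolding d by (intro real_sqrt_le_mono add_mono power_mono) (auto simp: distrib_left)
  also have "\<dots> \<le> energy_root p V w s1 u1 + energy_root p V w s2 u2"
    unfolding d by (rule real_sqrt_sum_squares_triangle_ineq)
  finally show ?thesis .
qed

lemma energy_root_eq_0:
  assumes "energy_root p V w s u = 0" "0 < V" "2 \<le> p" "0 < s" "0 \<le> u"
  shows "u = 0"
  using assms by (auto simp: energy_root_def sum_power2_eq_zero_iff)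

text \<open>
  The exponents match because \<open>(s\<^bsup>2/p-1\<^esup>)\<^sup>p = s\<^bsup>2-p\<^esup>\<close> and
  \<open>s\<^bsup>2(p-2)/p\<^esup> (s\<^bsup>2/p-1\<^esup>)\<^sup>2 = 1\<close> for \<open>s > 0\<close>.
\<close>

lemma integrand_eq_energy_root_square:
  assumes "2 \<le> p" "0 < V" "0 < s" "0 \<le> u"
  shows "V powr p * (2 / p * s powr (2 / p - 1) * u) powr p
      + V\<^sup>2 * rpow w (p - 2) * rpow s (2 * (p - 2) / p) * (2 / p * s powr (2 / p - 1) * u)\<^sup>2
    = (energy_root p V w s u)\<^sup>2"
proof -
  have sq: "(x powr (p / 2))\<^sup>2 = x powr p" for x :: real
    by (simp add: power2_eq_square flip: powr_add)
  have sq2: "(s powr r)\<^sup>2 = s powr (r + r)" for r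
    by (simp only: power2_eq_square powr_add)
  have s1: "(s powr (2 / p - 1)) powr p = s\<^sup>2 * (1 / s) powr p"
  proof -
    have "(s powr (2 / p - 1)) powr p = s powr (2 - p)"
      using assms by (simp add: powr_powr left_diff_distrib)
    also have "\<dots> = s\<^sup>2 * (1 / s) powr p"
      using assms by (simp add: powr_diff powr_divide)
    finally show ?thesis .
  qed
  have s2: "rpow s (2 * (p - 2) / p) * (s powr (2 / p - 1))\<^sup>2 = 1"
  proof -
    have "rpow s (2 * (p - 2) / p) * (s powr (2 / p - 1))\<^sup>2
        = s powr (2 * (p - 2) / p + ((2 / p - 1) + (2 / p - 1)))"
      using assms by (simp only: sq2 powr_add) (simp add: rpow_def)
    also have "2 * (p - 2) / p + ((2 / p - 1) + (2 / p - 1)) = 0"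
      using assms by (simp add: field_simps)
    finally show ?thesis using assms by simp
  qed
  have "V powr p * (2 / p * s powr (2 / p - 1) * u) powr p
      = (V powr (p / 2) * (2 / p) powr (p / 2) * (s * (u / s) powr (p / 2)))\<^sup>2"
    using assms by (simp add: powr_mult power_mult_distrib power_divide sq s1 powr_divide mult_ac)
  moreover have "V\<^sup>2 * rpow w (p - 2) * rpow s (2 * (p - 2) / p) * (2 / p * s powr (2 / p - 1) * u)\<^sup>2
      = V\<^sup>2 * rpow w (p - 2) * (2 / p)\<^sup>2 * u\<^sup>2
        * (rpow s (2 * (p - 2) / p) * (s powr (2 / p - 1))\<^sup>2)"
    unfolding power_mult_distrib by (simp only: ac_simps)
  moreover have "\<dots> = (V * sqrt (rpow w (p - 2)) * (2 / p) * u)\<^sup>2"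
    unfolding s2 by (simp add: power_mult_distrib power_divide rpow_nonneg)
  moreover have "(energy_root p V w s u)\<^sup>2
      = (V powr (p / 2) * (2 / p) powr (p / 2) * (s * (u / s) powr (p / 2)))\<^sup>2
        + (V * sqrt (rpow w (p - 2)) * (2 / p) * u)\<^sup>2"
    unfolding energy_root_def by (rule real_sqrt_pow2) simp
  ultimately show ?thesis
    by (simp only:)
qed

section \<open>Gradients\<close>

lemma cont_diff_1_differentiable: "cont_diff 1 S f \<Longrightarrow> x \<in> S \<Longrightarrow> f differentiable (at x)"
  by simp

lemma cont_diff_1_continuous_on: "cont_diff 1 S f \<Longrightarrow> continuous_on S f"
  by (meson cont_diff_1_differentiable continuous_at_imp_continuous_on
      differentiable_imp_continuous_within)

lemma cont_diff_1_continuous_on_grad: "cont_diff 1 S f \<Longrightarrow> continuous_on S (grad f)"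
  unfolding grad_def [abs_def] by (intro continuous_intros) simp_all

lemma grad_add:
  assumes "f differentiable (at x)" "g differentiable (at x)"
  shows "grad (\<lambda>x. f x + g x) x = grad f x + grad g x"
proof -
  have "((\<lambda>x. f x + g x) has_derivative
      (\<lambda>h. frechet_derivative f (at x) h + frechet_derivative g (at x) h)) (at x)"
    using assms by (intro has_derivative_add) (auto simp: frechet_derivative_works)
  from frechet_derivative_at[OF this, symmetric] show ?thesis
    by (simp add: grad_def scaleR_add_left sum.distrib)
qed

lemma grad_cmult:
  assumes "f differentiable (at x)"
  shows "grad (\<lambda>x. c * f x) x = c *\<^sub>R grad f x"
proof -
  have "((\<lambda>x. c * f x) has_derivative (\<lambda>h. c * frechet_derivative f (at x) h)) (at x)"
    using assms by (intro has_derivative_mult_right) (auto simp: frechet_derivative_works)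
  from frechet_derivative_at[OF this, symmetric] show ?thesis
    by (simp add: grad_def scaleR_sum_right)
qed

lemma grad_eq_0_imp_has_derivative:
  assumes "f differentiable (at x)" "grad f x = 0"
  shows "(f has_derivative (\<lambda>h. 0)) (at x)"
proof -
  let ?D = "frechet_derivative f (at x)"
  have D: "(f has_derivative ?D) (at x)"
    using assms by (simp add: frechet_derivative_works)
  have "?D b = 0" if "b \<in> Basis" for b
  proof -
    have "grad f x \<bullet> b = ?D b"
      using that by (simp add: grad_def inner_sum_left inner_Basis if_distrib cong: if_cong)
    with assms show ?thesis by simp
  qed
  then have "?D = (\<lambda>h. 0)"
    using has_derivative_linear[OF D]
    by (intro linear_eq_stdbasis) (auto simp: Real_Vector_Spaces.linear_iff)
  with D show ?thesis by simp
qed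

text \<open>A zero of a nonnegative function is a minimum.\<close>

lemma grad_eq_0_at_zero:
  assumes "f differentiable (at x)" "\<And>y. 0 \<le> f y" "f x = 0"
  shows "grad f x = 0"
proof -
  have "(f has_derivative frechet_derivative f (at x)) (at x)"
    using assms(1) by (simp add: frechet_derivative_works)
  then have "frechet_derivative f (at x) = (\<lambda>h. 0)"
    by (rule differential_zero_maxmin[of x UNIV, rotated 2]) (use assms(2,3) in auto)
  then show ?thesis by (simp add: grad_def)
qed

section \<open>Test functions\<close>

lemma
  assumes "\<psi> \<in> test_cone \<Omega>"
  shows test_cone_cont_diff: "cont_diff 1 \<Omega> \<psi>"
    and test_cone_nonneg: "0 \<le> \<psi> x"
    and test_cone_differentiable: "x \<in> \<Omega> \<Longrightarrow> \<psi> differentiable (at x)"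
proof -
  show *: "cont_diff 1 \<Omega> \<psi>"
    using assms unfolding test_cone_def smooth_on_def by blast
  show "0 \<le> \<psi> x"
    using assms by (auto simp: test_cone_def)
  show "x \<in> \<Omega> \<Longrightarrow> \<psi> differentiable (at x)"
    using * by (rule cont_diff_1_differentiable)
qed

text \<open>
  Outside \<open>\<Omega>\<close> a test function is locally zero, so its derivative vanishes on the whole space and it
  is constant there. The constant is zero because a compact support cannot be the whole space.
\<close>

lemma test_cone_grad_0_imp_0:
  fixes \<psi> :: "'a::euclidean_space \<Rightarrow> real"
  assumes \<psi>: "\<psi> \<in> test_cone \<Omega>" and g: "\<And>x. x \<in> \<Omega> \<Longrightarrow> grad \<psi> x = 0"
  shows "\<psi> = (\<lambda>x. 0)"
proof -
  let ?K = "closure {x. \<psi> x \<noteq> 0}"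
  have K: "compact ?K" "?K \<subseteq> \<Omega>"
    using \<psi> by (auto simp: test_cone_def)
  have D: "(\<psi> has_derivative (\<lambda>h. 0)) (at x)" for x
  proof (cases "x \<in> \<Omega>")
    case True
    then show ?thesis
      by (intro grad_eq_0_imp_has_derivative test_cone_differentiable[OF \<psi>] g)
  next
    case False
    with K have x: "x \<in> - ?K" by blast
    have eq: "\<psi> y = 0" if "y \<in> - ?K" for y
      using closure_subset[of "{x. \<psi> x \<noteq> 0}"] that by auto
    have "((\<lambda>_. 0) has_derivative (\<lambda>h. 0)) (at x)"
      by (rule has_derivative_const)
    then show ?thesis
      using open_Compl[OF closed_closure] x
      by (rule has_derivative_transform_within_open) (rule eq[symmetric])
  qed
  have "?K \<noteq> UNIV"
    using K(1) not_bounded_UNIV compact_imp_bounded by metis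
  then obtain z where z: "z \<notin> ?K" by blast
  then have "\<psi> z = 0"
    using closure_subset[of "{x. \<psi> x \<noteq> 0}"] by auto
  moreover have "\<psi> x = \<psi> z" for x
    using D by (intro has_derivative_zero_unique_connected[of UNIV \<psi>])
      (simp_all add: connected_UNIV)
  ultimately show ?thesis by auto
qed

section \<open>The functional as an \<open>L\<^sup>2\<close>-norm\<close>

definition energy_root_at ::
  "real \<Rightarrow> ('a::euclidean_space \<Rightarrow> real) \<Rightarrow> ('a \<Rightarrow> real) \<Rightarrow> 'a \<Rightarrow> real" where
  "energy_root_at p v \<psi> x = energy_root p (v x) (norm (grad v x)) (\<psi> x) (norm (grad \<psi> x))"

lemma energy_root_at_measurable:
  fixes \<Omega> :: "'a::euclidean_space set"
  assumes "cont_diff 1 \<Omega> v" "cont_diff 1 \<Omega> \<psi>"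
  shows "energy_root_at p v \<psi> \<in> borel_measurable (restrict_space lborel \<Omega>)"
proof -
  have m: "f \<in> borel_measurable (restrict_space lborel \<Omega>)" if "continuous_on \<Omega> f"
    for f :: "'a \<Rightarrow> 'b::topological_space"
    using borel_measurable_continuous_on_restrict[OF that]
    by (simp add: measurable_def space_restrict_space sets_restrict_space)
  note [measurable] = m[OF cont_diff_1_continuous_on[OF assms(1)]]
    m[OF cont_diff_1_continuous_on[OF assms(2)]]
    m[OF cont_diff_1_continuous_on_grad[OF assms(1)]]
    m[OF cont_diff_1_continuous_on_grad[OF assms(2)]]
  show ?thesis
    unfolding energy_root_at_def [abs_def] energy_root_def rpow_def by measurable
qed

text \<open>
  Stated for differentiable nonnegative functions, so that it applies to sums and multiples of test
  functions without first showing that these are test functions.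
\<close>

lemma cone_norm_eq:
  assumes "open \<Omega>" "2 \<le> p" "\<And>x. x \<in> \<Omega> \<Longrightarrow> 0 < v x"
    and diff: "\<And>x. x \<in> \<Omega> \<Longrightarrow> \<psi> differentiable (at x)" and nonneg: "\<And>x. 0 \<le> \<psi> x"
  shows "cone_norm \<Omega> p v \<psi>
    = ennsqrt (\<integral>\<^sup>+x. (ennreal (energy_root_at p v \<psi> x))\<^sup>2 \<partial>restrict_space lborel \<Omega>)"
proof -
  have "v x powr p * norm (grad_pow p \<psi> x) powr p +
     (v x)\<^sup>2 * rpow (norm (grad v x)) (p - 2) * rpow (\<psi> x) (2 * (p - 2) / p) *
       (norm (grad_pow p \<psi> x))\<^sup>2 = (energy_root_at p v \<psi> x)\<^sup>2" if x: "x \<in> \<Omega>" for x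
  proof (cases "\<psi> x = 0")
    case True
    then show ?thesis
      using grad_eq_0_at_zero[OF diff[OF x] nonneg True]
      by (simp add: grad_pow_def energy_root_at_def energy_root_def)
  next
    case False
    then have s: "0 < \<psi> x"
      using nonneg[of x] by simp
    then have n: "norm (grad_pow p \<psi> x) = 2 / p * \<psi> x powr (2 / p - 1) * norm (grad \<psi> x)"
      using assms(2) by (simp add: grad_pow_def)
    show ?thesis
      unfolding n energy_root_at_def
      using assms(2) assms(3)[OF x] s by (intro integrand_eq_energy_root_square) auto
  qed
  then have "(\<integral>\<^sup>+x\<in>\<Omega>. ennreal (
     v x powr p * norm (grad_pow p \<psi> x) powr p +
     (v x)\<^sup>2 * rpow (norm (grad v x)) (p - 2) * rpow (\<psi> x) (2 * (p - 2) / p) *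
       (norm (grad_pow p \<psi> x))\<^sup>2) \<partial>lborel)
    = (\<integral>\<^sup>+x\<in>\<Omega>. (ennreal (energy_root_at p v \<psi> x))\<^sup>2 \<partial>lborel)"
    by (intro nn_integral_cong)
      (auto simp: indicator_def ennreal_power energy_root_at_def energy_root_nonneg)
  also have "\<dots> = (\<integral>\<^sup>+x. (ennreal (energy_root_at p v \<psi> x))\<^sup>2 \<partial>restrict_space lborel \<Omega>)"
    using assms(1) by (intro nn_integral_restrict_space[symmetric]) auto
  finally show ?thesis
    by (simp add: cone_norm_def)
qed

lemma cone_norm_pos:
  assumes "open \<Omega>" "2 \<le> p" "\<And>x. x \<in> \<Omega> \<Longrightarrow> 0 < v x" "cont_diff 1 \<Omega> v"
    and \<psi>: "\<psi> \<in> test_cone \<Omega>" and "\<psi> \<noteq> (\<lambda>x. 0)"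
  shows "0 < cone_norm \<Omega> p v \<psi>"
proof (rule ccontr)
  have [measurable]: "energy_root_at p v \<psi> \<in> borel_measurable (restrict_space lborel \<Omega>)"
    using assms(4) test_cone_cont_diff[OF \<psi>] by (rule energy_root_at_measurable)
  assume "\<not> 0 < cone_norm \<Omega> p v \<psi>"
  then have "(\<integral>\<^sup>+x. (ennreal (energy_root_at p v \<psi> x))\<^sup>2 \<partial>restrict_space lborel \<Omega>) = 0"
    using cone_norm_eq[OF assms(1-3) test_cone_differentiable[OF \<psi>] test_cone_nonneg[OF \<psi>]]
    by (simp add: ennsqrt_eq_0_iff)
  then have "AE x in restrict_space lborel \<Omega>. (ennreal (energy_root_at p v \<psi> x))\<^sup>2 = 0"
    by (subst (asm) nn_integral_0_iff_AE) simp_all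
  then have "AE x in restrict_space lborel \<Omega>. energy_root_at p v \<psi> x = 0"
    by eventually_elim
      (simp add: energy_root_at_def energy_root_nonneg ennreal_eq_0_iff antisym)
  then have "AE x \<in> \<Omega> in lborel. energy_root_at p v \<psi> x = 0"
    using assms(1) by (subst (asm) AE_restrict_space_iff) auto
  then have AE0: "AE x \<in> \<Omega> in lborel. grad \<psi> x = 0"
  proof eventually_elim
    case (elim x)
    show ?case
    proof
      assume x: "x \<in> \<Omega>"
      show "grad \<psi> x = 0"
      proof (cases "\<psi> x = 0")
        case True
        then show ?thesis
          using grad_eq_0_at_zero test_cone_differentiable[OF \<psi> x] test_cone_nonneg[OF \<psi>] by blast
      next
        case False
        then have "0 < \<psi> x"
          using test_cone_nonneg[OF \<psi>, of x] by simp
        then have "norm (grad \<psi> x) = 0"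
          using elim x assms(2) assms(3)[OF x]
            energy_root_eq_0[of p "v x" "norm (grad v x)" "\<psi> x" "norm (grad \<psi> x)"]
          unfolding energy_root_at_def by (metis norm_ge_zero)
        then show ?thesis by simp
      qed
    qed
  qed
  let ?U = "{x \<in> \<Omega>. grad \<psi> x \<noteq> 0}"
  have "?U = \<Omega> \<inter> grad \<psi> -` (- {0})" by auto
  then have U: "open ?U"
    using continuous_open_preimage[OF cont_diff_1_continuous_on_grad[OF test_cone_cont_diff[OF \<psi>]]
        assms(1), of "- {0}"] by (simp add: open_Compl)
  have "AE x \<in> ?U in lebesgue. x \<in> {}"
    using AE_completion[OF AE0] by eventually_elim auto
  then have "?U = {}"
    using mem_closed_if_AE_lebesgue_open[OF U closed_empty] by blast
  then have "\<psi> = (\<lambda>x. 0)"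
    by (intro test_cone_grad_0_imp_0[OF \<psi>]) auto
  with assms show False by simp
qed

lemma cone_norm_scale:
  assumes "open \<Omega>" "2 \<le> p" "\<And>x. x \<in> \<Omega> \<Longrightarrow> 0 < v x" "cont_diff 1 \<Omega> v"
    and \<psi>: "\<psi> \<in> test_cone \<Omega>" and "0 \<le> c"
  shows "cone_norm \<Omega> p v (\<lambda>x. c * \<psi> x) = ennreal c * cone_norm \<Omega> p v \<psi>"
proof -
  let ?M = "restrict_space lborel \<Omega>"
  note diff = test_cone_differentiable[OF \<psi>] and nonneg = test_cone_nonneg[OF \<psi>]
  have [measurable]: "energy_root_at p v \<psi> \<in> borel_measurable ?M"
    using assms(4) test_cone_cont_diff[OF \<psi>] by (rule energy_root_at_measurable)
  have "energy_root_at p v (\<lambda>x. c * \<psi> x) x = c * energy_root_at p v \<psi> x" if "x \<in> \<Omega>" for x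
  proof (cases "c = 0")
    case True
    then show ?thesis by (simp add: energy_root_at_def energy_root_def grad_def)
  next
    case False
    with assms(6) show ?thesis
      by (simp add: energy_root_at_def grad_cmult[OF diff[OF that]] energy_root_scale)
  qed
  then have "(\<integral>\<^sup>+x. (ennreal (energy_root_at p v (\<lambda>x. c * \<psi> x) x))\<^sup>2 \<partial>?M)
      = (\<integral>\<^sup>+x. (ennreal c)\<^sup>2 * (ennreal (energy_root_at p v \<psi> x))\<^sup>2 \<partial>?M)"
    using assms(6)
    by (intro nn_integral_cong)
      (simp add: space_restrict_space ennreal_mult energy_root_at_def energy_root_nonneg power_mult_distrib)
  also have "\<dots> = (ennreal c)\<^sup>2 * (\<integral>\<^sup>+x. (ennreal (energy_root_at p v \<psi> x))\<^sup>2 \<partial>?M)"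
    by (intro nn_integral_cmult) measurable
  finally show ?thesis
    using cone_norm_eq[OF assms(1-3) diff nonneg]
      cone_norm_eq[OF assms(1-3), where \<psi> = "\<lambda>x. c * \<psi> x"] diff nonneg assms(6)
    by (simp add: ennsqrt_power2_mult)
qed

lemma cone_norm_triangle:
  assumes "open \<Omega>" "2 \<le> p" "\<And>x. x \<in> \<Omega> \<Longrightarrow> 0 < v x" "cont_diff 1 \<Omega> v"
    and \<psi>1: "\<psi>1 \<in> test_cone \<Omega>" and \<psi>2: "\<psi>2 \<in> test_cone \<Omega>"
  shows "cone_norm \<Omega> p v (\<lambda>x. \<psi>1 x + \<psi>2 x) \<le> cone_norm \<Omega> p v \<psi>1 + cone_norm \<Omega> p v \<psi>2"
proof -
  let ?M = "restrict_space lborel \<Omega>"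
  let ?h = "\<lambda>\<psi> x. ennreal (energy_root_at p v \<psi> x)"
  note diff1 = test_cone_differentiable[OF \<psi>1] and nonneg1 = test_cone_nonneg[OF \<psi>1]
  note diff2 = test_cone_differentiable[OF \<psi>2] and nonneg2 = test_cone_nonneg[OF \<psi>2]
  have m [measurable]: "?h \<psi>1 \<in> borel_measurable ?M" "?h \<psi>2 \<in> borel_measurable ?M"
    using energy_root_at_measurable[OF assms(4) test_cone_cont_diff[OF \<psi>1], of p]
      energy_root_at_measurable[OF assms(4) test_cone_cont_diff[OF \<psi>2], of p] by measurable
  have "?h (\<lambda>x. \<psi>1 x + \<psi>2 x) x \<le> ?h \<psi>1 x + ?h \<psi>2 x" if x: "x \<in> \<Omega>" for x
  proof -
    let ?d = "energy_root p (v x) (norm (grad v x))"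
    have "energy_root_at p v (\<lambda>x. \<psi>1 x + \<psi>2 x) x
        = ?d (\<psi>1 x + \<psi>2 x) (norm (grad \<psi>1 x + grad \<psi>2 x))"
      by (simp add: energy_root_at_def grad_add[OF diff1[OF x] diff2[OF x]])
    also have "\<dots> \<le> ?d (\<psi>1 x + \<psi>2 x) (norm (grad \<psi>1 x) + norm (grad \<psi>2 x))"
      using assms(2) assms(3)[OF x] nonneg1[of x] nonneg2[of x]
      by (intro energy_root_mono norm_triangle_ineq) auto
    also have "\<dots> \<le> energy_root_at p v \<psi>1 x + energy_root_at p v \<psi>2 x"
      unfolding energy_root_at_def
      using assms(2) assms(3)[OF x] nonneg1 nonneg2
        grad_eq_0_at_zero[OF diff1[OF x] nonneg1] grad_eq_0_at_zero[OF diff2[OF x] nonneg2]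
      by (intro energy_root_subadd) auto
    finally show ?thesis
      by (simp add: energy_root_at_def energy_root_nonneg ennreal_leI flip: ennreal_plus)
  qed
  then have "(\<integral>\<^sup>+x. (?h (\<lambda>x. \<psi>1 x + \<psi>2 x) x)\<^sup>2 \<partial>?M) \<le> (\<integral>\<^sup>+x. (?h \<psi>1 x + ?h \<psi>2 x)\<^sup>2 \<partial>?M)"
    by (intro nn_integral_mono power_mono) (auto simp: space_restrict_space)
  then have "ennsqrt (\<integral>\<^sup>+x. (?h (\<lambda>x. \<psi>1 x + \<psi>2 x) x)\<^sup>2 \<partial>?M)
      \<le> ennsqrt (\<integral>\<^sup>+x. (?h \<psi>1 x)\<^sup>2 \<partial>?M) + ennsqrt (\<integral>\<^sup>+x. (?h \<psi>2 x)\<^sup>2 \<partial>?M)"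
    using ennsqrt_mono ennsqrt_minkowski[OF m] order_trans by blast
  then show ?thesis
    using cone_norm_eq[OF assms(1-3) diff1 nonneg1] cone_norm_eq[OF assms(1-3) diff2 nonneg2]
      cone_norm_eq[OF assms(1-3), where \<psi> = "\<lambda>x. \<psi>1 x + \<psi>2 x"] diff1 diff2 nonneg1 nonneg2
    by simp
qed

theorem mainTheorem3:
  fixes \<Omega> :: "(real ^ 'n) set" and p :: real and v :: "real ^ 'n \<Rightarrow> real"
  assumes "open \<Omega>" and "connected \<Omega>"
    and "p \<ge> 2"
    and "cont_diff 1 \<Omega> v" and "\<forall>x\<in>\<Omega>. v x > 0"
  shows "(\<forall>\<psi>\<in>test_cone \<Omega>. \<psi> \<noteq> (\<lambda>x. 0) \<longrightarrow> cone_norm \<Omega> p v \<psi> > 0) \<and>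
    (\<forall>c\<ge>0. \<forall>\<psi>\<in>test_cone \<Omega>.
       cone_norm \<Omega> p v (\<lambda>x. c * \<psi> x) = ennreal c * cone_norm \<Omega> p v \<psi>) \<and>
    (\<forall>\<psi>\<^sub>1\<in>test_cone \<Omega>. \<forall>\<psi>\<^sub>2\<in>test_cone \<Omega>.
       cone_norm \<Omega> p v (\<lambda>x. \<psi>\<^sub>1 x + \<psi>\<^sub>2 x) \<le> cone_norm \<Omega> p v \<psi>\<^sub>1 + cone_norm \<Omega> p v \<psi>\<^sub>2)"
proof (intro conjI ballI allI impI)
  have v: "\<And>x. x \<in> \<Omega> \<Longrightarrow> 0 < v x"
    using assms(5) by blast
  show "0 < cone_norm \<Omega> p v \<psi>" if "\<psi> \<in> test_cone \<Omega>" "\<psi> \<noteq> (\<lambda>x. 0)" for \<psi>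
    using assms(1,3) v assms(4) that by (rule cone_norm_pos)
  show "cone_norm \<Omega> p v (\<lambda>x. c * \<psi> x) = ennreal c * cone_norm \<Omega> p v \<psi>"
    if "0 \<le> c" "\<psi> \<in> test_cone \<Omega>" for c \<psi>
    using assms(1,3) v assms(4) that(2,1) by (rule cone_norm_scale)
  show "cone_norm \<Omega> p v (\<lambda>x. \<psi>\<^sub>1 x + \<psi>\<^sub>2 x) \<le> cone_norm \<Omega> p v \<psi>\<^sub>1 + cone_norm \<Omega> p v \<psi>\<^sub>2"
    if "\<psi>\<^sub>1 \<in> test_cone \<Omega>" "\<psi>\<^sub>2 \<in> test_cone \<Omega>" for \<psi>\<^sub>1 \<psi>\<^sub>2
    using assms(1,3) v assms(4) that by (rule cone_norm_triangle)
qed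

end
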